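(* Let $x\in\mathbb{R}^n$. For a cone $N\subset\mathbb{R}^l$ define the subsets of $\Xi$ $$E_{N,x}:=\{\xi=(T,h)\in\Xi \mid h-Tx\in \operatorname{ri}(N)\},\qquad \overline{E}_{N,x}:=\{\xi=(T,h)\in\Xi \mid h-Tx\in N\},$$ and define the collections $$\mathcal{R}_x:=\{E_{N,x}\mid N\in\mathcal{N}(D)\},\qquad \overline{\mathcal{R}}_x:=\{\overline{E}_{N,x}\mid N\in\mathcal{N}(D)^{\max}\}.$$ Then, for every finite $\mathbb{P}$-partition $\mathcal{P}$ of $\Xi$, $$\mathcal{P}\preccurlyeq_{\mathbb{P}}\mathcal{R}_x\ \Longrightarrow\ V_{\mathcal{P}}(x)=V(x),$$ $$\mathcal{P}\preccurlyeq_{\mathbb{P}}\overline{\mathcal{R}}_x\ \Longleftrightarrow\ V_{\mathcal{P}}(x)=V(x).$$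
   Context: Setting. $(\Omega,\mathcal{A},\mathbb{P})$ is a probability space, $\Xi:=\mathbb{R}^{l\times n}\times\mathbb{R}^l$, and $\boldsymbol{\xi}=(\boldsymbol{T},\boldsymbol{h})$ is an integrable random variable with values in $\Xi$. The matrix $W\in\mathbb{R}^{l\times m}$ and the vector $q\in\mathbb{R}^m$ are deterministic. For $x\in\mathbb{R}^n$ and $\xi=(T,h)\in\Xi$, the recourse cost is $$Q(x,\xi):=\min_{y\in\mathbb{R}^m_+}\{q^\top y\mid Tx+Wy=h\},$$ with value $+\infty$ if infeasible. Let $D:=\{\lambda\in\mathbb{R}^l\mid W^\top\lambda\leq q\}$; it is assumed throughout that $D\neq\emptyset$, so that by strong duality $Q(x,\xi)=\sup_{\lambda\in D}(h-Tx)^\top\lambda$. Set $V(x):=\mathbb{E}[Q(x,\boldsymbol{\xi})]\in(-\infty,+\infty]$. For measurable $P\subset\Xi$ write $\mathbb{P}[P]:=\mathbb{P}[\boldsymbol{\xi}\in P]$ and $\mathbb{E}[\cdot\mid P]:=\mathbb{E}[\cdot\mid\boldsymbol{\xi}\in P]$. For measurable $E,F\subset\Xi$, $E\subset_{\mathbb{P}}F$ means $\mathbb{P}[E\cap F]=\mathbb{P}[E]$, and $E\sim_{\mathbb{P}}F$ means $\mathbb{P}[E\cap F]=\mathbb{P}[E]=\mathbb{P}[F]$. A $\mathbb{P}$-partition of $\Xi$ is a partition of $\Xi$ (into measurable sets) considered up to $\mathbb{P}$-equivalence $\sim_{\mathbb{P}}$ of its elements. For collections $\mathcal{P},\mathcal{R}$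 of subsets of $\Xi$, $\mathcal{P}\preccurlyeq_{\mathbb{P}}\mathcal{R}$ ("$\mathcal{P}$ refines $\mathcal{R}$") means: for every $P\in\mathcal{P}$ there is $R\in\mathcal{R}$ with $P\subset_{\mathbb{P}}R$. For a finite $\mathbb{P}$-partition $\mathcal{P}$, $$V_{\mathcal{P}}(x):=\sum_{P\in\mathcal{P}}\mathbb{P}[P]\,Q\big(x,\mathbb{E}[\boldsymbol{\xi}\mid P]\big),$$ with the convention that a term with $\mathbb{P}[P]=0$ equals $0$. The normal cone of $D$ at $\lambda\in D$ is $\{\psi\in\mathbb{R}^l\mid \psi^\top(\lambda'-\lambda)\leq 0\ \ \forall\lambda'\in D\}$. The normal fan $\mathcal{N}(D)$ is the (finite) collection of all normal cones of $D$ at points of $D$, and $\mathcal{N}(D)^{\max}$ is the collection of its inclusion-maximal elements. $\operatorname{ri}$ denotes the relative interior.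
   Formalization: The implication from V_P(x) = V(x) to P refining R̄_x is stated only for V(x) < +∞, since it fails when both values are +∞ (e.g. W = −1, q = 0, T = 0, h = 1 a.s., P = {Ξ}); the other implications hold for every x. *)

theory Defs
  imports "HOL-Probability.Probability" "HOL-Library.Disjoint_Sets"
begin

type_synonym ('l, 'n) scenario = "(real ^ 'n ^ 'l) \<times> (real ^ 'l)"

text \<open>
  Infimum in the extended reals, so an infeasible problem has value \<open>\<infinity>\<close>. If the
  dual feasible set below is nonempty, a feasible problem is bounded and, being a linear
  program, attains its minimum.
\<close>

definition recourse_cost ::
  "real ^ 'm ^ 'l \<Rightarrow> real ^ 'm \<Rightarrow> real ^ 'n \<Rightarrow> ('l, 'n) scenario \<Rightarrow> ereal" where
  "recourse_cost W q x \<xi> =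
     (INF y \<in> {y. (\<forall>j. 0 \<le> y $ j) \<and> fst \<xi> *v x + W *v y = snd \<xi>}. ereal (q \<bullet> y))"

definition dual_feasible :: "real ^ 'm ^ 'l \<Rightarrow> real ^ 'm \<Rightarrow> (real ^ 'l) set" where
  "dual_feasible W q = {u. \<forall>j. (transpose W *v u) $ j \<le> q $ j}"

text \<open>
  The Bochner integral is not available for \<open>ereal\<close>-valued functions. The difference below is
  the usual extended expectation whenever one of the two integrals is finite. For the recourse
  cost this is the case: for \<open>u\<close> in the dual feasible set, weak duality bounds it below by
  the integrable function \<open>(h - T x) \<bullet> u\<close>.
\<close>

definition ext_expectation :: "'w measure \<Rightarrow> ('w \<Rightarrow> ereal) \<Rightarrow> ereal" where
  "ext_expectation M f =
     enn2ereal (\<integral>\<^sup>+ w. e2ennreal (f w) \<partial>M) - enn2ereal (\<integral>\<^sup>+ w. e2ennreal (- f w) \<partial>M)"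

definition expected_cost ::
  "'w measure \<Rightarrow> ('w \<Rightarrow> ('l, 'n) scenario) \<Rightarrow> real ^ 'm ^ 'l \<Rightarrow> real ^ 'm \<Rightarrow> real ^ 'n \<Rightarrow> ereal" where
  "expected_cost M \<xi> W q x = ext_expectation M (\<lambda>w. recourse_cost W q x (\<xi> w))"

definition scen_prob :: "'w measure \<Rightarrow> ('w \<Rightarrow> 'a) \<Rightarrow> 'a set \<Rightarrow> real" where
  "scen_prob M \<xi> P = measure M {w \<in> space M. \<xi> w \<in> P}"

definition scen_cond_exp ::
  "'w measure \<Rightarrow> ('w \<Rightarrow> 'a::{banach, second_countable_topology}) \<Rightarrow> 'a set \<Rightarrow> 'a" where
  "scen_cond_exp M \<xi> P =
     (1 / scen_prob M \<xi> P) *\<^sub>R (LINT w:{w \<in> space M. \<xi> w \<in> P}|M. \<xi> w)"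

definition prob_subset :: "'w measure \<Rightarrow> ('w \<Rightarrow> 'a) \<Rightarrow> 'a set \<Rightarrow> 'a set \<Rightarrow> bool" where
  "prob_subset M \<xi> E F \<longleftrightarrow> scen_prob M \<xi> (E \<inter> F) = scen_prob M \<xi> E"

definition prob_equiv :: "'w measure \<Rightarrow> ('w \<Rightarrow> 'a) \<Rightarrow> 'a set \<Rightarrow> 'a set \<Rightarrow> bool" where
  "prob_equiv M \<xi> E F \<longleftrightarrow>
     scen_prob M \<xi> (E \<inter> F) = scen_prob M \<xi> E \<and> scen_prob M \<xi> (E \<inter> F) = scen_prob M \<xi> F"

text \<open>
  A partition up to equivalence of its elements: the elements correspond one-to-one to
  equivalent cells of a genuine measurable partition.  A bijection is required so that
  equivalent copies of a cell are not counted twice.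
\<close>

definition prob_partition ::
  "'w measure \<Rightarrow> ('w \<Rightarrow> 'a::topological_space) \<Rightarrow> 'a set set \<Rightarrow> bool" where
  "prob_partition M \<xi> \<P> \<longleftrightarrow>
     \<P> \<subseteq> sets borel \<and>
     (\<exists>\<Q> f. partition_on UNIV \<Q> \<and> \<Q> \<subseteq> sets borel \<and> bij_betw f \<P> \<Q> \<and>
            (\<forall>P\<in>\<P>. prob_equiv M \<xi> P (f P)))"

definition prob_refines :: "'w measure \<Rightarrow> ('w \<Rightarrow> 'a) \<Rightarrow> 'a set set \<Rightarrow> 'a set set \<Rightarrow> bool" where
  "prob_refines M \<xi> \<P> \<R> \<longleftrightarrow> (\<forall>P\<in>\<P>. \<exists>R\<in>\<R>. prob_subset M \<xi> P R)"

definition partitioned_cost ::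
  "'w measure \<Rightarrow> ('w \<Rightarrow> ('l, 'n) scenario) \<Rightarrow> real ^ 'm ^ 'l \<Rightarrow> real ^ 'm
     \<Rightarrow> ('l, 'n) scenario set set \<Rightarrow> real ^ 'n \<Rightarrow> ereal" where
  "partitioned_cost M \<xi> W q \<P> x =
     (\<Sum>P\<in>\<P>. if scen_prob M \<xi> P = 0 then 0
             else ereal (scen_prob M \<xi> P) * recourse_cost W q x (scen_cond_exp M \<xi> P))"

definition normal_cone :: "'a::real_inner set \<Rightarrow> 'a \<Rightarrow> 'a set" where
  "normal_cone D u = {\<psi>. \<forall>v\<in>D. \<psi> \<bullet> (v - u) \<le> 0}"

definition normal_fan :: "'a::real_inner set \<Rightarrow> 'a set set" where
  "normal_fan D = normal_cone D ` D"

definition maximal_elements :: "'a set set \<Rightarrow> 'a set set" where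
  "maximal_elements \<N> = {N \<in> \<N>. \<forall>N'\<in>\<N>. N \<subseteq> N' \<longrightarrow> N' = N}"

definition E_open :: "(real ^ 'l) set \<Rightarrow> real ^ 'n \<Rightarrow> ('l, 'n) scenario set" where
  "E_open N x = {(T, h). h - T *v x \<in> rel_interior N}"

definition E_closed :: "(real ^ 'l) set \<Rightarrow> real ^ 'n \<Rightarrow> ('l, 'n) scenario set" where
  "E_closed N x = {(T, h). h - T *v x \<in> N}"

definition R_open ::
  "real ^ 'm ^ 'l \<Rightarrow> real ^ 'm \<Rightarrow> real ^ 'n \<Rightarrow> ('l, 'n) scenario set set" where
  "R_open W q x = {E_open N x | N. N \<in> normal_fan (dual_feasible W q)}"

definition R_closed ::
  "real ^ 'm ^ 'l \<Rightarrow> real ^ 'm \<Rightarrow> real ^ 'n \<Rightarrow> ('l, 'n) scenario set set" where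
  "R_closed W q x = {E_closed N x | N. N \<in> maximal_elements (normal_fan (dual_feasible W q))}"

end

theory Submission
  imports Defs
begin

text \<open>
  By linear programming duality \<open>Q(x, \<xi>)\<close> is the support function of the dual feasible set \<open>D\<close> at
  the residual \<open>h - T x\<close>. It equals \<open>(h - T x) \<bullet> u\<close> exactly when the residual lies in the normal
  cone of \<open>D\<close> at \<open>u\<close>. If a cell is almost surely sent into one normal cone, then the conditional mean
  is too, since the cone is closed and convex, and on that cell both costs are given by the same linear
  functional. Conversely, if the expected cost is finite, then so is the cost at each conditional mean,
  hence it is attained at some \<open>u\<close>. The functional \<open>(h - T x) \<bullet> u\<close> is a lower bound for the cost, and
  equality of the expectations forces it to be almost surely tight on every cell. Normal cones depend
  only on the active constraints, so there are finitely many and each lies in a maximal one.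
\<close>

section \<open>Linear programming duality\<close>

text \<open>Exhibits the nonnegative orthant as a finitely generated cone, so that its linear images
  are finitely generated too and hence closed, as the separation in \<open>farkas\<close>
  requires.\<close>

lemma nonneg_eq_convex_cone_hull_Basis:
  "{y :: 'a::ordered_euclidean_space. 0 \<le> y} = convex_cone hull Basis"
proof
  show "{y :: 'a. 0 \<le> y} \<subseteq> convex_cone hull Basis"
  proof
    fix y :: 'a assume "y \<in> {y. 0 \<le> y}"
    then have nn: "0 \<le> y \<bullet> i" if "i \<in> Basis" for i
      using that by (auto simp: eucl_le[where 'a='a])
    have "(\<Sum>i\<in>B. (y \<bullet> i) *\<^sub>R i) \<in> convex_cone hull Basis" if "finite B" "B \<subseteq> Basis" for B
      using that
    proof (induction B)
      case empty
      then show ?case by (simp add: convex_cone_hull_contains_0)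
    next
      case (insert i B)
      then show ?case
        by (auto intro!: convex_cone_hull_add convex_cone_hull_mul nn intro: hull_inc)
    qed
    from this[of Basis] show "y \<in> convex_cone hull Basis"
      by (simp add: euclidean_representation)
  qed
  have "convex_cone {y :: 'a. 0 \<le> y}"
    by (auto simp: convex_cone_iff scaleR_nonneg_nonneg)
  then show "convex_cone hull Basis \<subseteq> {y :: 'a. 0 \<le> y}"
    by (intro hull_minimal) (auto simp: eucl_le[where 'a='a] inner_Basis)
qed

text \<open>A point outside the closed convex cone of attainable right-hand sides is strictly
  separated from it. Allowing arbitrary Euclidean spaces lets product types encode systems with
  several blocks of variables and constraints.\<close>

lemma farkas:
  fixes f :: "'a::ordered_euclidean_space \<Rightarrow> 'b::euclidean_space"
  assumes "linear f" and no_sol: "\<nexists>y. 0 \<le> y \<and> f y = b"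
  obtains z where "0 < z \<bullet> b" and "\<And>y. 0 \<le> y \<Longrightarrow> z \<bullet> f y \<le> 0"
proof -
  let ?C = "f ` {y. 0 \<le> y}"
  have C: "?C = convex_cone hull (f ` Basis)"
    by (simp add: nonneg_eq_convex_cone_hull_Basis convex_cone_hull_linear_image[OF \<open>linear f\<close>])
  have closed: "closed ?C" and convex: "convex ?C"
    unfolding C by (auto intro: closed_convex_cone_hull convex_convex_cone_hull)
  have "b \<notin> ?C"
    using no_sol by auto
  from separating_hyperplane_closed_point[OF convex closed this]
  obtain a c where ac: "a \<bullet> b < c" "\<And>v. v \<in> ?C \<Longrightarrow> c < a \<bullet> v"
    by blast
  have "0 \<in> ?C"
    unfolding C by (rule convex_cone_hull_contains_0)
  then have "c < 0"
    using ac(2)[of 0] by simp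
  have "a \<bullet> f y \<ge> 0" if "0 \<le> y" for y
  proof (rule ccontr)
    assume neg: "\<not> a \<bullet> f y \<ge> 0"
    \<comment> \<open>This scaling moves the image of \<open>y\<close> along its ray to where the
      functional is exactly \<open>c\<close>, against the strict inequality on the cone.\<close>
    let ?t = "c / (a \<bullet> f y)"
    have "0 \<le> ?t"
      using neg \<open>c < 0\<close> by (intro divide_nonpos_neg) auto
    then have "0 \<le> ?t *\<^sub>R y"
      using that by (rule scaleR_nonneg_nonneg)
    then have "c < a \<bullet> f (?t *\<^sub>R y)"
      by (intro ac(2) imageI CollectI)
    also have "\<dots> = c"
      using neg by (simp add: linear_scale[OF \<open>linear f\<close>])
    finally show False by simp
  qed
  then show thesis
    using ac(1) \<open>c < 0\<close> by (intro that[of "- a"]) auto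
qed

text \<open>The recourse cost depends on the scenario only through this vector, which for fixed
  \<open>x\<close> is linear in the scenario and therefore commutes with expectations.\<close>

definition residual :: "real ^ 'n \<Rightarrow> ('l::finite, 'n::finite) scenario \<Rightarrow> real ^ 'l" where
  "residual x \<xi> = snd \<xi> - fst \<xi> *v x"

lemma recourse_cost_residual:
  "recourse_cost W q x \<xi> = (INF y \<in> {y. 0 \<le> y \<and> W *v y = residual x \<xi>}. ereal (q \<bullet> y))"
  unfolding recourse_cost_def residual_def less_eq_vec_def
  by (rule arg_cong[where f = Inf], rule image_cong) (auto simp: algebra_simps)

lemma dual_feasible_iff: "u \<in> dual_feasible W q \<longleftrightarrow> u v* W \<le> q"
  by (simp add: dual_feasible_def less_eq_vec_def)

lemma inner_le_of_nonneg:
  fixes a b y :: "real ^ 'm"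
  assumes "a \<le> b" "0 \<le> y"
  shows "a \<bullet> y \<le> b \<bullet> y"
  using assms unfolding inner_vec_def less_eq_vec_def
  by (auto intro!: sum_mono mult_right_mono)

lemma weak_duality:
  assumes "u \<in> dual_feasible W q" "0 \<le> y"
  shows "(W *v y) \<bullet> u \<le> q \<bullet> y"
proof -
  have "(W *v y) \<bullet> u = (u v* W) \<bullet> y"
    unfolding dot_lmul_matrix by (rule inner_commute)
  also have "\<dots> \<le> q \<bullet> y"
    using assms by (intro inner_le_of_nonneg) (auto simp: dual_feasible_iff)
  finally show ?thesis .
qed

text \<open>Without such a \<open>y\<close>, \<open>farkas\<close> returns a multiplier
  \<open>(v, t)\<close> with \<open>t \<le> 0\<close>. It yields either a recession direction of the
  dual feasible set along which \<open>\<psi>\<close> increases, or, after scaling, a dual point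
  violating \<open>bound\<close>.\<close>

lemma primal_attained:
  assumes "dual_feasible W q \<noteq> {}"
    and bound: "\<And>u. u \<in> dual_feasible W q \<Longrightarrow> \<psi> \<bullet> u \<le> b"
  shows "\<exists>y\<ge>0. W *v y = \<psi> \<and> q \<bullet> y \<le> b"
proof (rule ccontr)
  assume none: "\<not> (\<exists>y\<ge>0. W *v y = \<psi> \<and> q \<bullet> y \<le> b)"
  \<comment> \<open>The slack \<open>s\<close> turns the bound \<open>q \<bullet> y \<le> b\<close>
    into an equation.\<close>
  let ?f = "\<lambda>(y, s::real). (W *v y, q \<bullet> y + s)"
  have "linear ?f"
    by (rule linearI) (auto simp: matrix_vector_right_distrib inner_add_right algebra_simps
        matrix_vector_mult_scaleR)
  moreover have "\<nexists>p. 0 \<le> p \<and> ?f p = (\<psi>, b)"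
    using none by (auto simp: less_eq_prod_def)
  ultimately obtain z where z: "0 < z \<bullet> (\<psi>, b)" "\<And>p. 0 \<le> p \<Longrightarrow> z \<bullet> ?f p \<le> 0"
    by (rule farkas) blast
  obtain v t where zvt: "z = (v, t)" by (cases z)
  have pos: "0 < v \<bullet> \<psi> + t * b"
    using z(1) by (simp add: zvt)
  have "t \<le> 0"
    using z(2)[of "(0, 1)"] by (simp add: zvt less_eq_prod_def)
  have ineq: "(v v* W) $ j + t * q $ j \<le> 0" for j
  proof -
    have "(0::real^'b) \<le> axis j 1"
      by (simp add: less_eq_vec_def axis_def)
    then have "v \<bullet> (W *v axis j 1) + t * (q \<bullet> axis j 1) \<le> 0"
      using z(2)[of "(axis j 1, 0)"] by (simp add: zvt less_eq_prod_def)
    moreover have "v \<bullet> (W *v axis j 1) = (v v* W) $ j"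
      by (simp add: dot_lmul_matrix[symmetric] inner_axis)
    ultimately show ?thesis
      by (simp add: inner_axis)
  qed
  show False
  proof (cases "t = 0")
    case True
    obtain u where u: "u \<in> dual_feasible W q"
      using assms(1) by auto
    have vpsi: "0 < \<psi> \<bullet> v"
      using pos True by (simp add: inner_commute)
    \<comment> \<open>The step along \<open>v\<close> is long enough to push the dual objective
      beyond \<open>b\<close>.\<close>
    define k where "k = (\<bar>b - \<psi> \<bullet> u\<bar> + 1) / (\<psi> \<bullet> v)"
    have "k > 0"
      using vpsi by (simp add: k_def)
    have "u + k *\<^sub>R v \<in> dual_feasible W q"
      unfolding dual_feasible_iff less_eq_vec_def
    proof
      fix j
      have "k * (v v* W) $ j \<le> 0"
        using ineq[of j] True \<open>k > 0\<close> by (simp add: mult_le_0_iff)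
      moreover have "(u v* W) $ j \<le> q $ j"
        using u by (simp add: dual_feasible_iff less_eq_vec_def)
      ultimately show "((u + k *\<^sub>R v) v* W) $ j \<le> q $ j"
        by (simp add: vector_matrix_left_distrib scaleR_vector_matrix_assoc)
    qed
    then have "\<psi> \<bullet> u + k * (\<psi> \<bullet> v) \<le> b"
      using bound[of "u + k *\<^sub>R v"] by (simp add: inner_add_right)
    then show False
      using vpsi by (simp add: k_def)
  next
    case False
    then have "t < 0"
      using \<open>t \<le> 0\<close> by simp
    \<comment> \<open>Scaling by \<open>k\<close> normalises the coefficient of \<open>q\<close> to
      -1.\<close>
    define k where "k = inverse (- t)"
    have k: "0 < k" "k * t = - 1"
      using \<open>t < 0\<close> by (simp_all add: k_def field_simps)
    have "k *\<^sub>R v \<in> dual_feasible W q"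
      unfolding dual_feasible_iff less_eq_vec_def
    proof
      fix j
      have "k * ((v v* W) $ j + t * q $ j) \<le> 0"
        using ineq[of j] k(1) by (simp add: mult_le_0_iff)
      also have "k * ((v v* W) $ j + t * q $ j) = k * (v v* W) $ j + (k * t) * q $ j"
        by (simp only: distrib_left mult.assoc)
      finally show "((k *\<^sub>R v) v* W) $ j \<le> q $ j"
        by (simp add: scaleR_vector_matrix_assoc k(2))
    qed
    then have "\<psi> \<bullet> (k *\<^sub>R v) \<le> b"
      by (rule bound)
    then have "k * (v \<bullet> \<psi>) + (k * t) * b \<le> 0"
      by (simp add: k(2) inner_commute)
    then have "k * (v \<bullet> \<psi> + t * b) \<le> 0"
      by (simp only: distrib_left mult.assoc)
    then show False
      using pos k(1) by (simp add: mult_le_0_iff)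
  qed
qed

text \<open>The nontrivial inequality is tested against real upper bounds of the supremum, for each
  of which \<open>primal_attained\<close> supplies a primal point. An infinite supremum has no such
  bound and needs no separate case.\<close>

lemma strong_duality:
  assumes "dual_feasible W q \<noteq> {}"
  shows "recourse_cost W q x \<xi> = (SUP u \<in> dual_feasible W q. ereal (residual x \<xi> \<bullet> u))"
proof (rule antisym)
  let ?\<psi> = "residual x \<xi>"
  show "(SUP u \<in> dual_feasible W q. ereal (?\<psi> \<bullet> u)) \<le> recourse_cost W q x \<xi>"
    unfolding recourse_cost_residual
  proof (intro SUP_least INF_greatest)
    fix u y assume "u \<in> dual_feasible W q" "y \<in> {y. 0 \<le> y \<and> W *v y = ?\<psi>}"
    then show "ereal (?\<psi> \<bullet> u) \<le> ereal (q \<bullet> y)"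
      using weak_duality[of u W q y] by auto
  qed
  show "recourse_cost W q x \<xi> \<le> (SUP u \<in> dual_feasible W q. ereal (?\<psi> \<bullet> u))"
  proof (rule ereal_le_real)
    fix b assume "(SUP u \<in> dual_feasible W q. ereal (?\<psi> \<bullet> u)) \<le> ereal b"
    then have "?\<psi> \<bullet> u \<le> b" if "u \<in> dual_feasible W q" for u
      using that by (auto simp: SUP_le_iff)
    then obtain y where "0 \<le> y" "W *v y = ?\<psi>" "q \<bullet> y \<le> b"
      using primal_attained[OF assms] by blast
    then show "recourse_cost W q x \<xi> \<le> ereal b"
      unfolding recourse_cost_residual by (intro INF_lower2[of y]) auto
  qed
qed

text \<open>If no dual point reached the finite optimal value, the infeasibility certificate from
  \<open>farkas\<close> would give a primal point cheaper than that value, or contradict weak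
  duality.\<close>

lemma dual_attained:
  assumes "dual_feasible W q \<noteq> {}"
    and cost: "recourse_cost W q x \<xi> < \<infinity>"
  obtains u where "u \<in> dual_feasible W q" "residual x \<xi> \<in> normal_cone (dual_feasible W q) u"
proof -
  let ?\<psi> = "residual x \<xi>"
  obtain u0 where u0: "u0 \<in> dual_feasible W q"
    using assms(1) by auto
  have "ereal (?\<psi> \<bullet> u0) \<le> recourse_cost W q x \<xi>"
    unfolding strong_duality[OF assms(1)] using u0 by (rule SUP_upper)
  then obtain b where b: "recourse_cost W q x \<xi> = ereal b"
    using cost by (cases "recourse_cost W q x \<xi>") auto
  have le_b: "?\<psi> \<bullet> u \<le> b" if "u \<in> dual_feasible W q" for u
    using b SUP_upper[OF that, of "\<lambda>u. ereal (?\<psi> \<bullet> u)"] by (simp add: strong_duality[OF assms(1)])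
  have b_le: "b \<le> q \<bullet> y" if "0 \<le> y" "W *v y = ?\<psi>" for y
  proof -
    have "recourse_cost W q x \<xi> \<le> ereal (q \<bullet> y)"
      unfolding recourse_cost_residual using that by (intro INF_lower) auto
    then show ?thesis
      by (simp add: b)
  qed
  have "\<exists>u \<in> dual_feasible W q. b \<le> ?\<psi> \<bullet> u"
  proof (rule ccontr)
    assume none: "\<not> (\<exists>u \<in> dual_feasible W q. b \<le> ?\<psi> \<bullet> u)"
    \<comment> \<open>The system \<open>u v* W \<le> q\<close>, \<open>b \<le> \<psi> \<bullet> u\<close> in standard form: the free variable is a difference of
      nonnegative ones and \<open>s\<close>, \<open>t\<close> are slacks.\<close>
    let ?f = "\<lambda>(u, u', s, t::real). ((u - u') v* W + s, t - ?\<psi> \<bullet> (u - u'))"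
    have "linear ?f"
      by (rule linearI) (auto simp: vector_matrix_left_distrib vector_matrix_mult_diff_distrib
        scaleR_vector_matrix_assoc inner_simps scaleR_right_distrib scaleR_right_diff_distrib
        right_diff_distrib)
    moreover have "\<nexists>p. 0 \<le> p \<and> ?f p = (q, - b)"
    proof
      assume "\<exists>p. 0 \<le> p \<and> ?f p = (q, - b)"
      then obtain u u' s t where st: "0 \<le> s" "0 \<le> t"
        and eq: "(u - u') v* W + s = q" "t - ?\<psi> \<bullet> (u - u') = - b"
        by (auto simp: less_eq_prod_def)
      have "u - u' \<in> dual_feasible W q"
        unfolding dual_feasible_iff eq(1)[symmetric] using st(1) by simp
      moreover have "b \<le> ?\<psi> \<bullet> (u - u')"
        using eq(2) st(2) by simp
      ultimately show False
        using none by blast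
    qed
    ultimately obtain z where z: "0 < z \<bullet> (q, - b)" "\<And>p. 0 \<le> p \<Longrightarrow> z \<bullet> ?f p \<le> 0"
      by (rule farkas) blast
    \<comment> \<open>With the signs reversed, the slack columns of \<open>?f\<close> make
      \<open>y\<close> and \<open>t\<close> nonnegative.\<close>
    obtain y t where zyt: "z = (- y, - t)"
      by (metis add.inverse_inverse surj_pair)
    have lt: "q \<bullet> y < t * b"
      using z(1) by (simp add: zyt inner_commute mult.commute)
    have "0 \<le> t"
      using z(2)[of "(0, 0, 0, 1)"] by (simp add: zyt less_eq_prod_def)
    have "0 \<le> y"
      unfolding less_eq_vec_def
    proof
      fix j
      have "(0::real^'b) \<le> axis j 1"
        by (simp add: less_eq_vec_def axis_def)
      then show "0 $ j \<le> y $ j"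
        using z(2)[of "(0, 0, axis j 1, 0)"] by (simp add: zyt less_eq_prod_def inner_axis)
    qed
    have "W *v y = t *\<^sub>R ?\<psi>"
      unfolding vec_eq_iff
    proof
      fix i
      let ?e = "axis i 1 :: real^'a"
      have "0 \<le> ?e"
        by (simp add: less_eq_vec_def axis_def)
      \<comment> \<open>The two halves of the free variable give opposite inequalities, hence an
        equation.\<close>
      then have "y \<bullet> (?e v* W) = t * (?\<psi> \<bullet> ?e)"
        using z(2)[of "(?e, 0, 0, 0)"] z(2)[of "(0, ?e, 0, 0)"]
        by (simp add: zyt less_eq_prod_def vector_matrix_mult_diff_distrib inner_diff_right)
      moreover have "y \<bullet> (?e v* W) = (W *v y) $ i"
        by (simp add: inner_commute[of y] dot_lmul_matrix inner_axis')
      ultimately show "(W *v y) $ i = (t *\<^sub>R ?\<psi>) $ i"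
        by (simp add: inner_axis)
    qed
    show False
    proof (cases "t = 0")
      case True
      then show False
        using weak_duality[OF u0 \<open>0 \<le> y\<close>] lt \<open>W *v y = t *\<^sub>R ?\<psi>\<close> by simp
    next
      case False
      then have "b \<le> q \<bullet> ((1 / t) *\<^sub>R y)"
        using \<open>0 \<le> y\<close> \<open>0 \<le> t\<close> \<open>W *v y = t *\<^sub>R ?\<psi>\<close>
        by (intro b_le scaleR_nonneg_nonneg) (auto simp: matrix_vector_mult_scaleR)
      then show False
        using lt False \<open>0 \<le> t\<close> by (simp add: field_simps)
    qed
  qed
  then obtain u where u: "u \<in> dual_feasible W q" "b \<le> ?\<psi> \<bullet> u"
    by auto
  show thesis
  proof (rule that[OF u(1)])
    show "?\<psi> \<in> normal_cone (dual_feasible W q) u"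
      using u(2) le_b by (fastforce simp: normal_cone_def inner_diff_right)
  qed
qed

text \<open>Membership in the normal cone says that \<open>u\<close> maximises the dual objective,
  so the supremum in \<open>strong_duality\<close> is attained there.\<close>

lemma recourse_cost_normal_cone:
  assumes "u \<in> dual_feasible W q" "residual x \<xi> \<in> normal_cone (dual_feasible W q) u"
  shows "recourse_cost W q x \<xi> = ereal (residual x \<xi> \<bullet> u)"
proof -
  have "dual_feasible W q \<noteq> {}"
    using assms(1) by auto
  then show ?thesis
    unfolding strong_duality[OF \<open>dual_feasible W q \<noteq> {}\<close>]
    using assms by (intro SUP_eqI) (auto simp: normal_cone_def inner_diff_right)
qed

section \<open>The normal fan\<close>

text \<open>The segment from \<open>u'\<close> to \<open>u\<close> can be prolonged slightly beyond \<open>u\<close> inside the dual feasible set, so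
  a functional that is maximal at \<open>u\<close> cannot be smaller at \<open>u'\<close>.\<close>

lemma normal_cone_mono_active:
  assumes u: "u \<in> dual_feasible W q" and u': "u' \<in> dual_feasible W q"
    and active: "\<And>j. (u v* W) $ j = q $ j \<Longrightarrow> (u' v* W) $ j = q $ j"
  shows "normal_cone (dual_feasible W q) u \<subseteq> normal_cone (dual_feasible W q) u'"
proof
  fix \<psi> assume \<psi>: "\<psi> \<in> normal_cone (dual_feasible W q) u"
  let ?d = "(u - u') v* W"
  have "\<forall>\<^sub>F e in at_right 0. \<forall>j. (u v* W) $ j + e * ?d $ j \<le> q $ j"
  proof (rule eventually_all_finite)
    fix j
    show "\<forall>\<^sub>F e in at_right 0. (u v* W) $ j + e * ?d $ j \<le> q $ j"
    proof (cases "(u v* W) $ j = q $ j")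
      case True
      then have "?d $ j = 0"
        using active by (simp add: vector_matrix_mult_diff_distrib)
      then show ?thesis
        using True by simp
    next
      case False
      then have "(u v* W) $ j + 0 * ?d $ j < q $ j"
        using u by (simp add: dual_feasible_iff less_eq_vec_def order_less_le)
      moreover have "((\<lambda>e. (u v* W) $ j + e * ?d $ j) \<longlongrightarrow> (u v* W) $ j + 0 * ?d $ j) (at_right 0)"
        by (intro tendsto_intros)
      ultimately have "\<forall>\<^sub>F e in at_right 0. (u v* W) $ j + e * ?d $ j < q $ j"
        by (simp add: order_tendstoD(2))
      then show ?thesis
        by (rule eventually_mono) simp
    qed
  qed
  moreover have "\<forall>\<^sub>F e in at_right (0::real). 0 < e"
    by (simp add: eventually_at_right_less)
  ultimately have "\<forall>\<^sub>F e in at_right 0. (\<forall>j. (u v* W) $ j + e * ?d $ j \<le> q $ j) \<and> 0 < e"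
    by (rule eventually_conj)
  then obtain e where e: "\<And>j. (u v* W) $ j + e * ?d $ j \<le> q $ j" "0 < e"
    using eventually_happens' trivial_limit_at_right_real by blast
  have "u + e *\<^sub>R (u - u') \<in> dual_feasible W q"
    unfolding dual_feasible_iff less_eq_vec_def
    using e(1) by (simp add: vector_matrix_left_distrib scaleR_vector_matrix_assoc)
  then have "\<psi> \<bullet> (e *\<^sub>R (u - u')) \<le> 0"
    using \<psi> by (force simp: normal_cone_def)
  then have "\<psi> \<bullet> u \<le> \<psi> \<bullet> u'"
    using e(2) by (simp add: inner_diff_right mult_le_0_iff)
  then show "\<psi> \<in> normal_cone (dual_feasible W q) u'"
    using \<psi> by (fastforce simp: normal_cone_def inner_diff_right)
qed

text \<open>By \<open>normal_cone_mono_active\<close> in both directions, points with the same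
  active constraints have the same normal cone, and there are finitely many sets of
  constraints.\<close>

lemma finite_normal_fan: "finite (normal_fan (dual_feasible W q))"
proof -
  let ?D = "dual_feasible W q" and ?A = "\<lambda>u. {j. (u v* W) $ j = q $ j}"
  \<comment> \<open>\<open>SOME\<close> picks a representative with active set \<open>I\<close>. If
    there is none, the value is arbitrary and harmless, since only an inclusion in
    \<open>range g\<close> is needed.\<close>
  define g where "g I = normal_cone ?D (SOME u. u \<in> ?D \<and> ?A u = I)" for I
  have "normal_cone ?D u = g (?A u)" if "u \<in> ?D" for u
  proof -
    have "(SOME v. v \<in> ?D \<and> ?A v = ?A u) \<in> ?D \<and> ?A (SOME v. v \<in> ?D \<and> ?A v = ?A u) = ?A u"
      by (rule someI[of "\<lambda>v. v \<in> ?D \<and> ?A v = ?A u"]) (use that in auto)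
    then have some: "(SOME v. v \<in> ?D \<and> ?A v = ?A u) \<in> ?D"
      and active: "((SOME v. v \<in> ?D \<and> ?A v = ?A u) v* W) $ j = q $ j \<longleftrightarrow> (u v* W) $ j = q $ j" for j
      by blast+
    show ?thesis
      unfolding g_def
      by (rule antisym; rule normal_cone_mono_active[OF that some] normal_cone_mono_active[OF some that];
        simp add: active)
  qed
  then have "normal_fan ?D \<subseteq> range g"
    by (auto simp: normal_fan_def)
  then show ?thesis
    by (rule finite_subset) simp
qed

lemma maximal_normal_cone:
  assumes "N \<in> normal_fan (dual_feasible W q)"
  obtains N' where "N' \<in> maximal_elements (normal_fan (dual_feasible W q))" "N \<subseteq> N'"
  using finite_has_maximal2[OF finite_normal_fan assms]
  by (auto simp: maximal_elements_def)

section \<open>Expectations over a partition\<close>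

lemma (in finite_measure) AE_in_subset_of_measure_eq:
  assumes "A \<in> sets M" "B \<in> sets M" "B \<subseteq> A" "measure M B = measure M A"
  shows "AE w in M. w \<in> A \<longrightarrow> w \<in> B"
proof -
  have "measure M (A - B) = 0"
    using assms by (simp add: finite_measure_Diff)
  then have "A - B \<in> null_sets M"
    using assms by (simp add: null_sets_def emeasure_eq_measure)
  from AE_not_in[OF this] show ?thesis
    by eventually_elim auto
qed

text \<open>Measurability of \<open>R\<close> is not assumed: \<open>measure\<close> vanishes off
  the sigma-algebra, so equality with the nonzero probability of \<open>P\<close> already makes the
  event of \<open>P \<inter> R\<close> measurable. Hence no measurability of \<open>E_open\<close>
  has to be shown.\<close>

lemma (in finite_measure) AE_of_prob_subset:
  assumes "\<xi> \<in> borel_measurable M" "P \<in> sets borel"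
    and sub: "prob_subset M \<xi> P R" and "scen_prob M \<xi> P \<noteq> 0"
  shows "AE w in M. \<xi> w \<in> P \<longrightarrow> \<xi> w \<in> R"
proof -
  let ?A = "{w \<in> space M. \<xi> w \<in> P}" and ?B = "{w \<in> space M. \<xi> w \<in> P \<inter> R}"
  have eq: "measure M ?B = measure M ?A" and "measure M ?A \<noteq> 0"
    using assms(3,4) by (auto simp: prob_subset_def scen_prob_def)
  then have "?B \<in> sets M"
    using measure_notin_sets[of ?B M] by auto
  moreover have "?A \<in> sets M"
    using assms(1,2) by measurable
  ultimately have "AE w in M. w \<in> ?A \<longrightarrow> w \<in> ?B"
    using eq by (intro AE_in_subset_of_measure_eq) auto
  with AE_space show ?thesis
    by eventually_elim auto
qed

lemma (in finite_measure) AE_of_prob_equiv: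
  assumes meas: "\<xi> \<in> borel_measurable M" "P \<in> sets borel" "Q \<in> sets borel"
    and equiv: "prob_equiv M \<xi> P Q"
  shows "AE w in M. \<xi> w \<in> P \<longleftrightarrow> \<xi> w \<in> Q"
proof -
  let ?A = "{w \<in> space M. \<xi> w \<in> P}" and ?B = "{w \<in> space M. \<xi> w \<in> Q}"
    and ?C = "{w \<in> space M. \<xi> w \<in> P \<inter> Q}"
  have "?A \<in> sets M" "?B \<in> sets M" "?C \<in> sets M"
    using meas by measurable
  moreover have "measure M ?C = measure M ?A" "measure M ?C = measure M ?B"
    using equiv by (auto simp: prob_equiv_def scen_prob_def)
  ultimately have "AE w in M. w \<in> ?A \<longrightarrow> w \<in> ?C" "AE w in M. w \<in> ?B \<longrightarrow> w \<in> ?C"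
    by (intro AE_in_subset_of_measure_eq; force)+
  with AE_space show ?thesis
    by eventually_elim auto
qed

text \<open>Almost surely the cells may be exchanged for those of a genuine partition, where exactly
  one indicator is 1. The sum expresses covering and disjointness at once and serves as a partition
  of unity under the integral.\<close>

lemma (in finite_measure) AE_prob_partition:
  assumes \<xi>: "\<xi> \<in> borel_measurable M" and fin: "finite \<P>" and part: "prob_partition M \<xi> \<P>"
  shows "AE w in M. (\<Sum>P\<in>\<P>. indicator {w \<in> space M. \<xi> w \<in> P} w) = (1::real)"
proof -
  obtain \<Q> f where \<Q>: "partition_on UNIV \<Q>" "\<Q> \<subseteq> sets borel" "bij_betw f \<P> \<Q>"
    and equiv: "\<And>P. P \<in> \<P> \<Longrightarrow> prob_equiv M \<xi> P (f P)" and \<P>: "\<P> \<subseteq> sets borel"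
    using part by (auto simp: prob_partition_def)
  have "AE w in M. \<forall>P\<in>\<P>. \<xi> w \<in> P \<longleftrightarrow> \<xi> w \<in> f P"
  proof (rule AE_finite_allI[OF fin])
    fix P assume "P \<in> \<P>"
    moreover from this have "f P \<in> \<Q>"
      using \<Q>(3) by (auto simp: bij_betw_def)
    ultimately show "AE w in M. \<xi> w \<in> P \<longleftrightarrow> \<xi> w \<in> f P"
      using \<xi> \<P> \<Q>(2) equiv by (intro AE_of_prob_equiv) auto
  qed
  with AE_space show ?thesis
  proof eventually_elim
    fix w assume w: "w \<in> space M" "\<forall>P\<in>\<P>. \<xi> w \<in> P \<longleftrightarrow> \<xi> w \<in> f P"
    obtain Q where Q: "Q \<in> \<Q>" "\<xi> w \<in> Q"
      using partition_onD1[OF \<Q>(1)] by blast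
    have uniq: "Q' = Q" if "Q' \<in> \<Q>" "\<xi> w \<in> Q'" for Q'
      using partition_onD2[OF \<Q>(1)] that Q by (auto simp: disjoint_def)
    have "finite \<Q>"
      using fin \<Q>(3) bij_betw_finite by blast
    have "(\<Sum>P\<in>\<P>. indicator {w \<in> space M. \<xi> w \<in> P} w) = (\<Sum>P\<in>\<P>. indicator (f P) (\<xi> w) :: real)"
      using w by (intro sum.cong) (auto simp: indicator_def)
    also have "\<dots> = (\<Sum>Q'\<in>\<Q>. indicator Q' (\<xi> w))"
      \<comment> \<open>Bijectivity of \<open>f\<close> ensures that each genuine cell is counted
        exactly once.\<close>
      by (rule sum.reindex_bij_betw[OF \<Q>(3)])
    also have "\<dots> = (\<Sum>Q'\<in>\<Q>. if Q' = Q then 1 else 0)"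
    proof (rule sum.cong)
      fix Q' assume "Q' \<in> \<Q>"
      then show "indicator Q' (\<xi> w) = (if Q' = Q then 1 else 0 :: real)"
        using uniq[of Q'] Q(2) by (cases "\<xi> w \<in> Q'") auto
    qed simp
    also have "\<dots> = 1"
      using Q \<open>finite \<Q>\<close> by simp
    finally show "(\<Sum>P\<in>\<P>. indicator {w \<in> space M. \<xi> w \<in> P} w) = (1::real)" .
  qed
qed

lemma (in finite_measure) integral_prob_partition:
  fixes g :: "'a \<Rightarrow> real"
  assumes \<xi>: "\<xi> \<in> borel_measurable M" and fin: "finite \<P>" and part: "prob_partition M \<xi> \<P>"
    and g: "integrable M g"
  shows "integral\<^sup>L M g = (\<Sum>P\<in>\<P>. LINT w:{w \<in> space M. \<xi> w \<in> P}|M. g w)"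
proof -
  have sets: "{w \<in> space M. \<xi> w \<in> P} \<in> sets M" if "P \<in> \<P>" for P
    using that part measurable_sets_Collect[OF \<xi>, of "\<lambda>y. y \<in> P"] by (auto simp: prob_partition_def)
  have int: "integrable M (\<lambda>w. indicator {w \<in> space M. \<xi> w \<in> P} w *\<^sub>R g w)" if "P \<in> \<P>" for P
    by (rule integrable_mult_indicator[OF sets[OF that] g])
  have "AE w in M. g w = (\<Sum>P\<in>\<P>. indicator {w \<in> space M. \<xi> w \<in> P} w *\<^sub>R g w)"
    using AE_prob_partition[OF \<xi> fin part]
    by eventually_elim (simp add: sum_distrib_right[symmetric])
  then have "integral\<^sup>L M g = (LINT w|M. (\<Sum>P\<in>\<P>. indicator {w \<in> space M. \<xi> w \<in> P} w *\<^sub>R g w))"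
    using g int by (intro integral_cong_AE borel_measurable_integrable Bochner_Integration.integrable_sum) auto
  also have "\<dots> = (\<Sum>P\<in>\<P>. LINT w:{w \<in> space M. \<xi> w \<in> P}|M. g w)"
    unfolding set_lebesgue_integral_def using int by (rule Bochner_Integration.integral_sum)
  finally show ?thesis .
qed

section \<open>Integrability of residuals and of the recourse cost\<close>

lemma bounded_linear_residual: "bounded_linear (residual x)"
proof -
  have "linear (residual x)"
    by (rule linearI) (simp_all add: residual_def matrix_vector_mult_add_rdistrib
        scaleR_matrix_vector_assoc[symmetric] scaleR_right_diff_distrib)
  then show ?thesis
    by (simp add: linear_conv_bounded_linear)
qed

lemma integrable_residual:
  assumes "integrable M \<xi>"
  shows "integrable M (\<lambda>w. residual x (\<xi> w) \<bullet> u)"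
  using integrable_bounded_linear[OF bounded_linear_residual assms] by (rule integrable_inner_left)

text \<open>A linear functional commutes with the conditional mean. For a null cell both sides are
  0, because division by zero gives 0.\<close>

lemma residual_scen_cond_exp:
  assumes \<xi>: "integrable M \<xi>" and "P \<in> sets borel"
  shows "residual x (scen_cond_exp M \<xi> P) \<bullet> u =
    (LINT w:{w \<in> space M. \<xi> w \<in> P}|M. residual x (\<xi> w) \<bullet> u) / scen_prob M \<xi> P"
proof -
  let ?A = "{w \<in> space M. \<xi> w \<in> P}"
  have lin: "bounded_linear (\<lambda>z. residual x z \<bullet> u)"
    using bounded_linear_residual by (rule bounded_linear_inner_left_comp)
  have "?A \<in> sets M"
    using borel_measurable_integrable[OF \<xi>] assms(2) by measurable
  then have "integrable M (\<lambda>w. indicator ?A w *\<^sub>R \<xi> w)"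
    using \<xi> by (rule integrable_mult_indicator)
  from integral_bounded_linear[OF lin this]
  have "(LINT w:?A|M. residual x (\<xi> w) \<bullet> u) = residual x (LINT w:?A|M. \<xi> w) \<bullet> u"
    by (simp add: set_lebesgue_integral_def linear_scale[OF bounded_linear.linear[OF lin]])
  then show ?thesis
    by (simp add: scen_cond_exp_def linear_scale[OF bounded_linear.linear[OF lin]])
qed

lemma ext_expectation_eq_integral:
  assumes g: "integrable M g" and eq: "AE w in M. f w = ereal (g w)"
  shows "ext_expectation M f = ereal (integral\<^sup>L M g)"
proof -
  have "(\<integral>\<^sup>+ w. e2ennreal (f w) \<partial>M) = (\<integral>\<^sup>+ w. ennreal (g w) \<partial>M)"
    using eq by (intro nn_integral_cong_AE) auto
  moreover have "(\<integral>\<^sup>+ w. e2ennreal (- f w) \<partial>M) = (\<integral>\<^sup>+ w. ennreal (- g w) \<partial>M)"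
    using eq by (intro nn_integral_cong_AE) auto
  moreover have "enn2ereal a = ereal (enn2real a)" if "a \<noteq> \<infinity>" for a
    using that by (cases a) auto
  ultimately show ?thesis
    using g by (simp add: ext_expectation_def real_lebesgue_integral_def real_integrable_def)
qed

text \<open>As a supremum of continuous functions the cost is lower semicontinuous, so its strict
  superlevel sets are open in scenario space. Openness takes care of a possibly uncountable set of
  dual points.\<close>

lemma measurable_recourse_cost:
  assumes "dual_feasible W q \<noteq> {}" "\<xi> \<in> borel_measurable M"
  shows "(\<lambda>w. recourse_cost W q x (\<xi> w)) \<in> borel_measurable M"
proof (rule borel_measurableI_greater)
  fix y :: ereal
  let ?U = "\<Union>u\<in>dual_feasible W q. {z. y < ereal (residual x z \<bullet> u)}"
  have "open ?U"
  proof (intro open_UN ballI)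
    fix u
    have "continuous_on UNIV (\<lambda>z. residual x z \<bullet> u)"
      by (intro continuous_intros linear_continuous_on bounded_linear_residual)
    then have "continuous_on UNIV (\<lambda>z. ereal (residual x z \<bullet> u))"
      by (rule continuous_on_ereal)
    then show "open {z. y < ereal (residual x z \<bullet> u)}"
      by (intro open_Collect_less continuous_on_const)
  qed
  then have "?U \<in> sets borel"
    by simp
  then have "{w \<in> space M. \<xi> w \<in> ?U} \<in> sets M"
    using assms(2) by measurable
  also have "{w \<in> space M. \<xi> w \<in> ?U} = {w \<in> space M. y < recourse_cost W q x (\<xi> w)}"
    by (auto simp: strong_duality[OF assms(1)] less_SUP_iff)
  finally show "{w \<in> space M. y < recourse_cost W q x (\<xi> w)} \<in> sets M" .
qed

text \<open>One fixed dual point gives an integrable minorant, so the negative part always has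
  finite integral. A finite expectation then bounds the positive part, leaving an integrable real
  version of the cost.\<close>

lemma expected_cost_finite:
  assumes D: "dual_feasible W q \<noteq> {}" and \<xi>: "integrable M \<xi>"
    and fin: "expected_cost M \<xi> W q x < \<infinity>"
  obtains r where "integrable M r" "AE w in M. recourse_cost W q x (\<xi> w) = ereal (r w)"
proof -
  define g where "g w = recourse_cost W q x (\<xi> w)" for w
  have g: "g \<in> borel_measurable M"
    unfolding g_def using D \<xi> by (intro measurable_recourse_cost) auto
  obtain u where u: "u \<in> dual_feasible W q"
    using D by auto
  have lower: "ereal (residual x (\<xi> w) \<bullet> u) \<le> g w" for w
    unfolding g_def strong_duality[OF D] using u by (rule SUP_upper)
  have "(\<integral>\<^sup>+ w. e2ennreal (- g w) \<partial>M) \<le> (\<integral>\<^sup>+ w. ennreal (- (residual x (\<xi> w) \<bullet> u)) \<partial>M)"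
  proof (rule nn_integral_mono)
    fix w
    have "- g w \<le> ereal (- (residual x (\<xi> w) \<bullet> u))"
      using lower[of w] by (simp flip: uminus_ereal.simps)
    then show "e2ennreal (- g w) \<le> ennreal (- (residual x (\<xi> w) \<bullet> u))"
      unfolding e2ennreal_ereal[symmetric] by (rule e2ennreal_mono)
  qed
  also have "\<dots> < \<infinity>"
    using integrable_residual[OF \<xi>, of x u] by (simp add: real_integrable_def top.not_eq_extremum)
  finally have neg: "(\<integral>\<^sup>+ w. e2ennreal (- g w) \<partial>M) \<noteq> \<infinity>"
    by simp
  have pos: "(\<integral>\<^sup>+ w. e2ennreal (g w) \<partial>M) \<noteq> \<infinity>"
  proof
    assume "(\<integral>\<^sup>+ w. e2ennreal (g w) \<partial>M) = \<infinity>"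
    then have "expected_cost M \<xi> W q x = \<infinity>"
      using neg by (simp add: expected_cost_def ext_expectation_def flip: g_def)
    with fin show False
      by simp
  qed
  have "AE w in M. e2ennreal (g w) \<noteq> \<infinity>"
    using g pos by (intro nn_integral_noteq_infinite) auto
  then have eq: "AE w in M. g w = ereal (real_of_ereal (g w))"
  proof eventually_elim
    fix w assume "e2ennreal (g w) \<noteq> \<infinity>"
    then show "g w = ereal (real_of_ereal (g w))"
      \<comment> \<open>The minorant excludes the value minus infinity.\<close>
      using lower[of w] by (cases "g w") auto
  qed
  have "integrable M (\<lambda>w. real_of_ereal (g w))"
    unfolding real_integrable_def
  proof (intro conjI)
    show "(\<lambda>w. real_of_ereal (g w)) \<in> borel_measurable M"
      using g by measurable
    have "(\<integral>\<^sup>+ w. ennreal (real_of_ereal (g w)) \<partial>M) = (\<integral>\<^sup>+ w. e2ennreal (g w) \<partial>M)"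
      using eq by (intro nn_integral_cong_AE, eventually_elim) (metis e2ennreal_ereal)
    with pos show "(\<integral>\<^sup>+ w. ennreal (real_of_ereal (g w)) \<partial>M) \<noteq> \<infinity>"
      by simp
    have "(\<integral>\<^sup>+ w. ennreal (- real_of_ereal (g w)) \<partial>M) = (\<integral>\<^sup>+ w. e2ennreal (- g w) \<partial>M)"
      using eq by (intro nn_integral_cong_AE, eventually_elim) (metis e2ennreal_ereal uminus_ereal.simps(1))
    with neg show "(\<integral>\<^sup>+ w. ennreal (- real_of_ereal (g w)) \<partial>M) \<noteq> \<infinity>"
      by simp
  qed
  with eq show thesis
    by (intro that) (simp_all add: g_def)
qed

section \<open>Refinement implies equality of the costs\<close>

text \<open>Up to null sets the cost is glued from one linear functional per cell. The conditional
  mean of a cell lies in the same cone, so the functional also gives the cost there, and linearity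
  matches the two sides term by term.\<close>

lemma (in prob_space) partitioned_cost_eq_if_affine_on_cells:
  assumes \<xi>: "integrable M \<xi>" and fin: "finite \<P>" and part: "prob_partition M \<xi> \<P>"
    and cells: "\<And>P. P \<in> \<P> \<Longrightarrow> scen_prob M \<xi> P \<noteq> 0 \<Longrightarrow>
      \<exists>u\<in>dual_feasible W q. AE w in M. \<xi> w \<in> P \<longrightarrow>
        residual x (\<xi> w) \<in> normal_cone (dual_feasible W q) u"
  shows "partitioned_cost M \<xi> W q \<P> x = expected_cost M \<xi> W q x"
proof -
  let ?D = "dual_feasible W q"
  let ?A = "\<lambda>P. {w \<in> space M. \<xi> w \<in> P}"
  have \<xi>_meas: "\<xi> \<in> borel_measurable M"
    using \<xi> by simp
  have \<P>: "P \<in> sets borel" if "P \<in> \<P>" for P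
    using part that by (auto simp: prob_partition_def)
  have sets: "?A P \<in> sets M" if "P \<in> \<P>" for P
    using \<xi>_meas \<P>[OF that] by measurable
  have "\<forall>P\<in>{P \<in> \<P>. scen_prob M \<xi> P \<noteq> 0}. \<exists>u. u \<in> ?D \<and>
      (AE w in M. \<xi> w \<in> P \<longrightarrow> residual x (\<xi> w) \<in> normal_cone ?D u)"
    using cells by blast
  from bchoice[OF this] obtain U
    where U: "\<And>P. P \<in> \<P> \<Longrightarrow> scen_prob M \<xi> P \<noteq> 0 \<Longrightarrow> U P \<in> ?D"
    and AE_U: "\<And>P. P \<in> \<P> \<Longrightarrow> scen_prob M \<xi> P \<noteq> 0 \<Longrightarrow>
      AE w in M. \<xi> w \<in> P \<longrightarrow> residual x (\<xi> w) \<in> normal_cone ?D (U P)"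
    by blast
  \<comment> \<open>On null cells \<open>U P\<close> is unconstrained, but those terms vanish almost
    everywhere.\<close>
  define g where "g w = (\<Sum>P\<in>\<P>. indicator (?A P) w *\<^sub>R (residual x (\<xi> w) \<bullet> U P))" for w
  have int: "integrable M (\<lambda>w. indicator (?A P) w *\<^sub>R (residual x (\<xi> w) \<bullet> U P))" if "P \<in> \<P>" for P
    using sets[OF that] by (rule integrable_mult_indicator) (rule integrable_residual[OF \<xi>])
  have null: "AE w in M. w \<notin> ?A P" if "P \<in> \<P>" "scen_prob M \<xi> P = 0" for P
    using that sets by (intro AE_not_in) (auto simp: null_sets_def emeasure_eq_measure scen_prob_def)
  have "AE w in M. \<forall>P\<in>\<P>. w \<in> ?A P \<longrightarrow>
      recourse_cost W q x (\<xi> w) = ereal (residual x (\<xi> w) \<bullet> U P)"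
  proof (rule AE_finite_allI[OF fin])
    fix P assume P: "P \<in> \<P>"
    show "AE w in M. w \<in> ?A P \<longrightarrow> recourse_cost W q x (\<xi> w) = ereal (residual x (\<xi> w) \<bullet> U P)"
    proof (cases "scen_prob M \<xi> P = 0")
      case True
      from null[OF P this] show ?thesis
        by eventually_elim auto
    next
      case False
      from AE_U[OF P this] show ?thesis
        by eventually_elim (use U[OF P False] in \<open>auto intro: recourse_cost_normal_cone\<close>)
    qed
  qed
  with AE_prob_partition[OF \<xi>_meas fin part]
  have "AE w in M. recourse_cost W q x (\<xi> w) = ereal (g w)"
  proof eventually_elim
    fix w
    assume one: "(\<Sum>P\<in>\<P>. indicator (?A P) w) = (1::real)"
      and cost: "\<forall>P\<in>\<P>. w \<in> ?A P \<longrightarrow> recourse_cost W q x (\<xi> w) = ereal (residual x (\<xi> w) \<bullet> U P)"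
    have "\<exists>P\<in>\<P>. w \<in> ?A P"
    proof (rule ccontr)
      assume "\<not> (\<exists>P\<in>\<P>. w \<in> ?A P)"
      then have "(\<Sum>P\<in>\<P>. indicator (?A P) w) = (0::real)"
        by (intro sum.neutral) (auto simp: indicator_def)
      with one show False by simp
    qed
    then obtain c where c: "recourse_cost W q x (\<xi> w) = ereal c"
      using cost by auto
    \<comment> \<open>Every cell containing \<open>w\<close> contributes the same value
      \<open>c\<close>, so it factors out of the partition of unity.\<close>
    have "g w = (\<Sum>P\<in>\<P>. indicator (?A P) w * c)"
      unfolding g_def
    proof (rule sum.cong)
      fix P assume "P \<in> \<P>"
      then show "indicator (?A P) w *\<^sub>R (residual x (\<xi> w) \<bullet> U P) = indicator (?A P) w * c"
        using cost c by (cases "w \<in> ?A P") auto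
    qed simp
    also have "\<dots> = c"
      using one by (simp flip: sum_distrib_right)
    finally show "recourse_cost W q x (\<xi> w) = ereal (g w)"
      using c by simp
  qed
  moreover have "integrable M g"
    unfolding g_def by (rule Bochner_Integration.integrable_sum) (rule int)
  ultimately have "expected_cost M \<xi> W q x = ereal (integral\<^sup>L M g)"
    unfolding expected_cost_def by (intro ext_expectation_eq_integral)
  also have "integral\<^sup>L M g = (\<Sum>P\<in>\<P>. LINT w:?A P|M. residual x (\<xi> w) \<bullet> U P)"
    unfolding g_def set_lebesgue_integral_def using int by (rule Bochner_Integration.integral_sum)
  also have "ereal \<dots> = (\<Sum>P\<in>\<P>. ereal (LINT w:?A P|M. residual x (\<xi> w) \<bullet> U P))"
    by simp
  also have "\<dots> = partitioned_cost M \<xi> W q \<P> x"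
    unfolding partitioned_cost_def
  proof (rule sum.cong)
    fix P assume P: "P \<in> \<P>"
    let ?p = "scen_prob M \<xi> P" and ?\<psi> = "residual x (scen_cond_exp M \<xi> P)"
    show "ereal (LINT w:?A P|M. residual x (\<xi> w) \<bullet> U P) =
      (if ?p = 0 then 0 else ereal ?p * recourse_cost W q x (scen_cond_exp M \<xi> P))"
    proof (cases "?p = 0")
      case True
      have "(LINT w:?A P|M. residual x (\<xi> w) \<bullet> U P) = 0"
        unfolding set_lebesgue_integral_def
        using null[OF P True] by (intro integral_eq_zero_AE, eventually_elim) auto
      with True show ?thesis by simp
    next
      case False
      have "0 < ?p"
        using False by (simp add: scen_prob_def zero_less_measure_iff)
      have "?\<psi> \<in> normal_cone ?D (U P)"
        unfolding normal_cone_def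
      proof (intro CollectI ballI)
        fix v assume v: "v \<in> ?D"
        \<comment> \<open>The inequalities defining the cone are integrated over the cell one
          \<open>v\<close> at a time, which puts the mean into the cone.\<close>
        have "0 \<le> (LINT w:?A P|M. residual x (\<xi> w) \<bullet> (U P - v))"
          unfolding set_lebesgue_integral_def
        proof (rule integral_nonneg_AE)
          show "AE w in M. 0 \<le> indicator (?A P) w *\<^sub>R (residual x (\<xi> w) \<bullet> (U P - v))"
            using AE_U[OF P False]
            by eventually_elim (use v in \<open>auto simp: normal_cone_def indicator_def inner_diff_right\<close>)
        qed
        then have "0 \<le> ?\<psi> \<bullet> (U P - v)"
          using \<open>0 < ?p\<close> by (simp add: residual_scen_cond_exp[OF \<xi> \<P>[OF P]])
        then show "?\<psi> \<bullet> (v - U P) \<le> 0"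
          by (simp add: inner_diff_right)
      qed
      then have "recourse_cost W q x (scen_cond_exp M \<xi> P) = ereal (?\<psi> \<bullet> U P)"
        using U[OF P False] by (intro recourse_cost_normal_cone)
      then show ?thesis
        using False by (simp add: residual_scen_cond_exp[OF \<xi> \<P>[OF P]])
    qed
  qed simp
  finally show ?thesis by simp
qed

text \<open>Keeping \<open>\<R>\<close> abstract covers \<open>R_open\<close> and
  \<open>R_closed\<close> together: each of their members lies inside some
  \<open>E_closed N x\<close>.\<close>

lemma (in prob_space) partitioned_cost_eq_if_refines:
  assumes \<xi>: "integrable M \<xi>" and fin: "finite \<P>" and part: "prob_partition M \<xi> \<P>"
    and ref: "prob_refines M \<xi> \<P> \<R>"
    and \<R>: "\<And>R. R \<in> \<R> \<Longrightarrow> \<exists>N\<in>normal_fan (dual_feasible W q). R \<subseteq> E_closed N x"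
  shows "partitioned_cost M \<xi> W q \<P> x = expected_cost M \<xi> W q x"
proof (rule partitioned_cost_eq_if_affine_on_cells[OF \<xi> fin part])
  fix P assume P: "P \<in> \<P>" "scen_prob M \<xi> P \<noteq> 0"
  then obtain R where R: "R \<in> \<R>" "prob_subset M \<xi> P R"
    using ref by (auto simp: prob_refines_def)
  then obtain u where u: "u \<in> dual_feasible W q" "R \<subseteq> E_closed (normal_cone (dual_feasible W q) u) x"
    using \<R>[OF R(1)] by (auto simp: normal_fan_def)
  have "AE w in M. \<xi> w \<in> P \<longrightarrow> \<xi> w \<in> R"
    using \<xi> part P R by (intro AE_of_prob_subset) (auto simp: prob_partition_def)
  then have "AE w in M. \<xi> w \<in> P \<longrightarrow> residual x (\<xi> w) \<in> normal_cone (dual_feasible W q) u"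
    by eventually_elim (use u(2) in \<open>auto simp: E_closed_def residual_def\<close>)
  with u(1) show "\<exists>u\<in>dual_feasible W q. AE w in M. \<xi> w \<in> P \<longrightarrow>
      residual x (\<xi> w) \<in> normal_cone (dual_feasible W q) u"
    by blast
qed

section \<open>Equality of the costs implies refinement\<close>

lemma E_closed_measurable:
  assumes "N \<in> normal_fan D"
  shows "E_closed N x \<in> sets borel"
proof -
  obtain u where N: "N = normal_cone D u"
    using assms by (auto simp: normal_fan_def)
  have "E_closed N x = (\<Inter>v\<in>D. {z. residual x z \<bullet> (v - u) \<le> 0})"
    by (auto simp: E_closed_def N normal_cone_def residual_def)
  moreover have "closed \<dots>"
    by (intro closed_INT ballI closed_Collect_le continuous_intros linear_continuous_on
        bounded_linear_residual)
  ultimately show ?thesis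
    by simp
qed

text \<open>The difference of the two costs is a finite sum of nonnegative cell gaps, each the
  integral of a function that is almost surely nonnegative. Equality forces every gap, and then
  every integrand, to vanish almost surely.\<close>

lemma (in prob_space) refines_if_partitioned_cost_eq:
  assumes \<xi>: "integrable M \<xi>" and fin: "finite \<P>" and part: "prob_partition M \<xi> \<P>"
    and D: "dual_feasible W q \<noteq> {}" and V: "expected_cost M \<xi> W q x < \<infinity>"
    and eq: "partitioned_cost M \<xi> W q \<P> x = expected_cost M \<xi> W q x"
  shows "prob_refines M \<xi> \<P> (R_closed W q x)"
proof -
  let ?D = "dual_feasible W q"
  let ?A = "\<lambda>P. {w \<in> space M. \<xi> w \<in> P}"
  let ?p = "scen_prob M \<xi>" and ?c = "\<lambda>P. recourse_cost W q x (scen_cond_exp M \<xi> P)"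
  have \<xi>_meas: "\<xi> \<in> borel_measurable M"
    using \<xi> by simp
  have \<P>: "P \<in> sets borel" if "P \<in> \<P>" for P
    using part that by (auto simp: prob_partition_def)
  have sets: "?A P \<in> sets M" if "P \<in> sets borel" for P
    using \<xi>_meas that by measurable
  have p_pos: "0 < ?p P" if "?p P \<noteq> 0" for P
    using that by (simp add: scen_prob_def zero_less_measure_iff)
  obtain r where r: "integrable M r" and r_eq: "AE w in M. recourse_cost W q x (\<xi> w) = ereal (r w)"
    using expected_cost_finite[OF D \<xi> V] .
  have r_ge: "AE w in M. \<forall>u\<in>?D. residual x (\<xi> w) \<bullet> u \<le> r w"
    using r_eq
  proof eventually_elim
    fix w assume w: "recourse_cost W q x (\<xi> w) = ereal (r w)"
    show "\<forall>u\<in>?D. residual x (\<xi> w) \<bullet> u \<le> r w"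
    proof
      fix u assume "u \<in> ?D"
      from SUP_upper[OF this, of "\<lambda>u. ereal (residual x (\<xi> w) \<bullet> u)"] w
      show "residual x (\<xi> w) \<bullet> u \<le> r w"
        by (simp add: strong_duality[OF D])
    qed
  qed
  have int: "set_integrable M (?A P) r" "set_integrable M (?A P) (\<lambda>w. residual x (\<xi> w) \<bullet> u)"
    if "P \<in> \<P>" for P u
    unfolding set_integrable_def
    by (intro integrable_mult_indicator sets \<P> that r integrable_residual[OF \<xi>])+
  have cell_le: "(LINT w:?A P|M. residual x (\<xi> w) \<bullet> u) \<le> (LINT w:?A P|M. r w)"
    if "P \<in> \<P>" "u \<in> ?D" for P u
    unfolding set_lebesgue_integral_def
  proof (rule integral_mono_AE)
    show "AE w in M. indicator (?A P) w *\<^sub>R (residual x (\<xi> w) \<bullet> u) \<le> indicator (?A P) w *\<^sub>R r w"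
      using r_ge by eventually_elim (use that in \<open>auto simp: indicator_def\<close>)
  qed (use int[OF that(1)] in \<open>auto simp: set_integrable_def\<close>)
  have "\<exists>u. u \<in> ?D \<and> ?c P = ereal ((LINT w:?A P|M. residual x (\<xi> w) \<bullet> u) / ?p P)"
    if P: "P \<in> \<P>" "?p P \<noteq> 0" for P
  proof -
    \<comment> \<open>A Jensen-type bound: the cost at the mean is at most the mean cost, hence
      finite, so \<open>dual_attained\<close> applies.\<close>
    have "?c P \<le> ereal ((LINT w:?A P|M. r w) / ?p P)"
      unfolding strong_duality[OF D]
    proof (rule SUP_least)
      fix u assume "u \<in> ?D"
      then show "ereal (residual x (scen_cond_exp M \<xi> P) \<bullet> u) \<le> ereal ((LINT w:?A P|M. r w) / ?p P)"
        using cell_le[OF P(1)] p_pos[OF P(2)]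
        by (simp add: residual_scen_cond_exp[OF \<xi> \<P>[OF P(1)]] divide_right_mono)
    qed
    also have "\<dots> < \<infinity>"
      by simp
    finally obtain u where u: "u \<in> ?D"
      "residual x (scen_cond_exp M \<xi> P) \<in> normal_cone ?D u"
      using dual_attained[OF D] by blast
    from recourse_cost_normal_cone[OF this] u(1) show ?thesis
      by (auto simp: residual_scen_cond_exp[OF \<xi> \<P>[OF P(1)]])
  qed
  then have "\<forall>P\<in>{P \<in> \<P>. ?p P \<noteq> 0}. \<exists>u. u \<in> ?D \<and>
      ?c P = ereal ((LINT w:?A P|M. residual x (\<xi> w) \<bullet> u) / ?p P)"
    by blast
  from bchoice[OF this] obtain U where U: "\<And>P. P \<in> \<P> \<Longrightarrow> ?p P \<noteq> 0 \<Longrightarrow> U P \<in> ?D"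
    and c_eq: "\<And>P. P \<in> \<P> \<Longrightarrow> ?p P \<noteq> 0 \<Longrightarrow>
      ?c P = ereal ((LINT w:?A P|M. residual x (\<xi> w) \<bullet> U P) / ?p P)"
    by blast
  \<comment> \<open>The guards reproduce the convention of \<open>partitioned_cost\<close> for null
    cells, where \<open>U P\<close> is unspecified.\<close>
  define gap where "gap P = (if ?p P = 0 then 0 else LINT w:?A P|M. r w) -
    (if ?p P = 0 then 0 else LINT w:?A P|M. residual x (\<xi> w) \<bullet> U P)" for P
  have "partitioned_cost M \<xi> W q \<P> x =
      (\<Sum>P\<in>\<P>. ereal (if ?p P = 0 then 0 else LINT w:?A P|M. residual x (\<xi> w) \<bullet> U P))"
    unfolding partitioned_cost_def by (intro sum.cong) (auto simp: c_eq)
  moreover have "expected_cost M \<xi> W q x = ereal (\<Sum>P\<in>\<P>. LINT w:?A P|M. r w)"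
    unfolding expected_cost_def ext_expectation_eq_integral[OF r r_eq]
      integral_prob_partition[OF \<xi>_meas fin part r] ..
  ultimately have "(\<Sum>P\<in>\<P>. if ?p P = 0 then 0 else LINT w:?A P|M. residual x (\<xi> w) \<bullet> U P) =
      (\<Sum>P\<in>\<P>. LINT w:?A P|M. r w)"
    using eq by simp
  also have "\<dots> = (\<Sum>P\<in>\<P>. if ?p P = 0 then 0 else LINT w:?A P|M. r w)"
  proof (rule sum.cong)
    fix P assume P: "P \<in> \<P>"
    have "(LINT w:?A P|M. r w) = 0" if "?p P = 0"
    proof -
      have "AE w in M. w \<notin> ?A P"
        using that sets[OF \<P>[OF P]]
        by (intro AE_not_in) (auto simp: null_sets_def emeasure_eq_measure scen_prob_def)
      then show ?thesis
        unfolding set_lebesgue_integral_def by (intro integral_eq_zero_AE, eventually_elim) auto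
    qed
    then show "(LINT w:?A P|M. r w) = (if ?p P = 0 then 0 else LINT w:?A P|M. r w)"
      by simp
  qed simp
  finally have "(\<Sum>P\<in>\<P>. gap P) = 0"
    by (simp add: gap_def sum_subtractf)
  moreover have "0 \<le> gap P" if "P \<in> \<P>" for P
    using cell_le[OF that U[OF that]] by (simp add: gap_def)
  ultimately have gap: "gap P = 0" if "P \<in> \<P>" for P
    using that fin by (simp add: sum_nonneg_eq_0_iff)
  show ?thesis
    unfolding prob_refines_def
  proof
    fix P assume P: "P \<in> \<P>"
    show "\<exists>R\<in>R_closed W q x. prob_subset M \<xi> P R"
    proof (cases "?p P = 0")
      case True
      \<comment> \<open>A null cell is contained in any set up to probability zero, so it only
        remains to show that \<open>R_closed\<close> has a member.\<close>
      obtain u where "u \<in> ?D"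
        using D by auto
      then have "normal_cone ?D u \<in> normal_fan ?D"
        by (auto simp: normal_fan_def)
      then obtain N where "N \<in> maximal_elements (normal_fan ?D)"
        by (rule maximal_normal_cone)
      then have N: "E_closed N x \<in> R_closed W q x" "N \<in> normal_fan ?D"
        by (auto simp: R_closed_def maximal_elements_def)
      have "?p (P \<inter> E_closed N x) \<le> ?p P"
        unfolding scen_prob_def using sets[OF \<P>[OF P]] by (intro finite_measure_mono) auto
      then have "prob_subset M \<xi> P (E_closed N x)"
        using True by (simp add: prob_subset_def scen_prob_def measure_le_0_iff)
      with N(1) show ?thesis by blast
    next
      case False
      have diff_int: "integrable M (\<lambda>w. indicator (?A P) w *\<^sub>R (r w - residual x (\<xi> w) \<bullet> U P))"
        using set_integral_diff(1)[OF int(1)[OF P] int(2)[OF P, of "U P"]]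
        by (simp add: set_integrable_def)
      have "(LINT w|M. indicator (?A P) w *\<^sub>R (r w - residual x (\<xi> w) \<bullet> U P)) = 0"
        using gap[OF P] False set_integral_diff(2)[OF int(1)[OF P] int(2)[OF P, of "U P"]]
        by (simp add: gap_def set_lebesgue_integral_def)
      moreover have "AE w in M. 0 \<le> indicator (?A P) w *\<^sub>R (r w - residual x (\<xi> w) \<bullet> U P)"
        using r_ge by eventually_elim (use U[OF P False] in \<open>auto simp: indicator_def\<close>)
      ultimately have "AE w in M. indicator (?A P) w *\<^sub>R (r w - residual x (\<xi> w) \<bullet> U P) = 0"
        using integral_nonneg_eq_0_iff_AE[OF diff_int] by simp
      \<comment> \<open>Where the integrand vanishes on the cell, \<open>U P\<close> attains the
        upper bound \<open>r w\<close> of all dual values, so it is a maximiser.\<close>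
      with r_ge AE_space have cone: "AE w in M. \<xi> w \<in> P \<longrightarrow> residual x (\<xi> w) \<in> normal_cone ?D (U P)"
      proof eventually_elim
        fix w
        assume "\<forall>u\<in>?D. residual x (\<xi> w) \<bullet> u \<le> r w" "w \<in> space M"
          "indicator (?A P) w *\<^sub>R (r w - residual x (\<xi> w) \<bullet> U P) = 0"
        then show "\<xi> w \<in> P \<longrightarrow> residual x (\<xi> w) \<in> normal_cone ?D (U P)"
          by (auto simp: normal_cone_def inner_diff_right)
      qed
      have "normal_cone ?D (U P) \<in> normal_fan ?D"
        using U[OF P False] by (auto simp: normal_fan_def)
      then obtain N where N_max: "N \<in> maximal_elements (normal_fan ?D)"
        and N_sup: "normal_cone ?D (U P) \<subseteq> N"
        by (rule maximal_normal_cone)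
      have "E_closed N x \<in> sets borel"
        using N_max by (intro E_closed_measurable[of _ ?D]) (simp add: maximal_elements_def)
      then have "?p (P \<inter> E_closed N x) = ?p P"
        unfolding scen_prob_def
      proof (intro measure_eq_AE sets)
        show "AE w in M. w \<in> ?A (P \<inter> E_closed N x) \<longleftrightarrow> w \<in> ?A P"
          using cone by eventually_elim (use N_sup in \<open>auto simp: E_closed_def residual_def\<close>)
      qed (use \<P>[OF P] in auto)
      moreover have "E_closed N x \<in> R_closed W q x"
        using N_max by (auto simp: R_closed_def)
      ultimately show ?thesis
        by (auto simp: prob_subset_def)
    qed
  qed
qed

text \<open>Finiteness is essential in the last implication: for a constant scenario of infinite
  recourse cost both costs are infinite, yet no normal cone contains the residual, so a cell of
  positive probability cannot refine \<open>R_closed\<close>.\<close>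

theorem theorem3:
  fixes M :: "'w measure"
    and \<xi> :: "'w \<Rightarrow> (real ^ 'n ^ 'l) \<times> (real ^ 'l)"
    and W :: "real ^ 'm ^ 'l"
    and q :: "real ^ 'm"
    and x :: "real ^ 'n"
    and \<P> :: "((real ^ 'n ^ 'l) \<times> (real ^ 'l)) set set"
  assumes "prob_space M"
    and "integrable M \<xi>"
    and "dual_feasible W q \<noteq> {}"
    and "finite \<P>"
    and "prob_partition M \<xi> \<P>"
  shows "(prob_refines M \<xi> \<P> (R_open W q x) \<longrightarrow>
            partitioned_cost M \<xi> W q \<P> x = expected_cost M \<xi> W q x) \<and>
         (prob_refines M \<xi> \<P> (R_closed W q x) \<longrightarrow>
            partitioned_cost M \<xi> W q \<P> x = expected_cost M \<xi> W q x) \<and>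
         (expected_cost M \<xi> W q x < \<infinity> \<longrightarrow>
            partitioned_cost M \<xi> W q \<P> x = expected_cost M \<xi> W q x \<longrightarrow>
            prob_refines M \<xi> \<P> (R_closed W q x))"
proof -
  interpret prob_space M by fact
  note refines = partitioned_cost_eq_if_refines[OF assms(2,4,5)]
  show ?thesis
  proof (intro conjI impI)
    assume "prob_refines M \<xi> \<P> (R_open W q x)"
    then show "partitioned_cost M \<xi> W q \<P> x = expected_cost M \<xi> W q x"
    proof (rule refines)
      fix R assume "R \<in> R_open W q x"
      then obtain N where "N \<in> normal_fan (dual_feasible W q)" "R = E_open N x"
        by (auto simp: R_open_def)
      then show "\<exists>N\<in>normal_fan (dual_feasible W q). R \<subseteq> E_closed N x"
        using rel_interior_subset[of N] by (auto simp: E_open_def E_closed_def)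
    qed
  next
    assume "prob_refines M \<xi> \<P> (R_closed W q x)"
    then show "partitioned_cost M \<xi> W q \<P> x = expected_cost M \<xi> W q x"
      by (rule refines) (auto simp: R_closed_def maximal_elements_def)
  next
    assume "expected_cost M \<xi> W q x < \<infinity>"
      "partitioned_cost M \<xi> W q \<P> x = expected_cost M \<xi> W q x"
    then show "prob_refines M \<xi> \<P> (R_closed W q x)"
      by (rule refines_if_partitioned_cost_eq[OF assms(2,4,5,3)])
  qed
qed

end
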